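(* The non Desargues complex $\mathcal{N}=(E,N)$ admits no proper matroid extension.
   Context: Let $K_5$ be the complete graph on $\{1,2,3,4,5\}$ and $E$ its set of edges (2-subsets, written $ab$). Let $D$ be the set of all edge sets of subforests of $K_5$ with at most $3$ edges, let $L_0=\{34,35,45\}$, and set $N=D\cup\{L_0\}$; the non Desargues complex is $\mathcal{N}=(E,N)$, a simplicial complex of dimension $2$. A simplicial complex is a pair $(V,H)$ with $V$ finite nonempty, $H\subseteq 2^V$ containing all singletons and closed under subsets; its dimension is $\max\{|X|:X\in H\}-1$; it is a matroid if for all $I,J\in H$ with $|I|=|J|+1$ there is $i\in I\setminus J$ with $J\cup\{i\}\in H$. An extension of a complex $(V,H)$ of dimension $d$ is a complex $(V,H')$ with $H'\cap P_{\le d+1}(V)=H$, where $P_{\le k}(V)$ is the set of subsets with at most $k$ elements; it is proper if $H'\ne H$. *)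

theory Defs
  imports Main
begin

definition simplicial_complex :: "'a set \<Rightarrow> 'a set set \<Rightarrow> bool" where
  "simplicial_complex V H \<longleftrightarrow>
     finite V \<and> V \<noteq> {} \<and> H \<subseteq> Pow V \<and> (\<forall>v\<in>V. {v} \<in> H) \<and> (\<forall>X\<in>H. \<forall>Y. Y \<subseteq> X \<longrightarrow> Y \<in> H)"

(* The truncated subtraction is harmless: a complex has a singleton face, so the maximum is positive. *)
definition complex_dim :: "'a set set \<Rightarrow> nat" where
  "complex_dim H = Max (card ` H) - 1"

definition matroid :: "'a set \<Rightarrow> 'a set set \<Rightarrow> bool" where
  "matroid V H \<longleftrightarrow> simplicial_complex V H \<and>
     (\<forall>I\<in>H. \<forall>J\<in>H. card I = card J + 1 \<longrightarrow> (\<exists>i\<in>I - J. J \<union> {i} \<in> H))"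

definition subsets_upto :: "nat \<Rightarrow> 'a set \<Rightarrow> 'a set set" where
  "subsets_upto k V = {X. X \<subseteq> V \<and> card X \<le> k}"

definition complex_extension :: "'a set \<Rightarrow> 'a set set \<Rightarrow> 'a set set \<Rightarrow> bool" where
  "complex_extension V H H' \<longleftrightarrow>
     simplicial_complex V H' \<and> H' \<inter> subsets_upto (complex_dim H + 1) V = H"

definition proper_extension :: "'a set \<Rightarrow> 'a set set \<Rightarrow> 'a set set \<Rightarrow> bool" where
  "proper_extension V H H' \<longleftrightarrow> complex_extension V H H' \<and> H' \<noteq> H"

definition complete_edges :: "'v set \<Rightarrow> 'v set set" where
  "complete_edges W = {e. e \<subseteq> W \<and> card e = 2}"

definition graph_cycle :: "'v set set \<Rightarrow> 'v list \<Rightarrow> bool" where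
  "graph_cycle F vs \<longleftrightarrow> 3 \<le> length vs \<and> distinct vs \<and>
     (\<forall>i<length vs. {vs ! i, vs ! (Suc i mod length vs)} \<in> F)"

definition forest :: "'v set \<Rightarrow> 'v set set \<Rightarrow> bool" where
  "forest W F \<longleftrightarrow> F \<subseteq> complete_edges W \<and> (\<nexists>vs. graph_cycle F vs)"

definition K5_vertices :: "nat set" where
  "K5_vertices = {1, 2, 3, 4, 5}"

definition K5_edges :: "nat set set" where
  "K5_edges = complete_edges K5_vertices"

definition desargues_faces :: "nat set set set" where
  "desargues_faces = {F. (\<exists>W. W \<subseteq> K5_vertices \<and> forest W F) \<and> card F \<le> 3}"

definition non_desargues_faces :: "nat set set set" where
  "non_desargues_faces = desargues_faces \<union> {{{3, 4}, {3, 5}, {4, 5}}}"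

lemma graph_cycle_card:
  assumes c: "graph_cycle F vs" and "finite F"
  shows "3 \<le> card F"
proof -
  let ?n = "length vs"
  have n: "3 \<le> ?n" and d: "distinct vs"
    and e: "\<And>i. i < ?n \<Longrightarrow> {vs ! i, vs ! (Suc i mod ?n)} \<in> F"
    using c by (auto simp: graph_cycle_def)
  let ?a = "vs ! 0" and ?b = "vs ! 1" and ?c = "vs ! 2" and ?d = "vs ! (3 mod ?n)"
  have m: "3 mod ?n = 0 \<or> 3 mod ?n = 3 \<and> 3 < ?n"
    using n by (cases "?n = 3") auto
  have neq: "vs ! i \<noteq> vs ! j" if "i < ?n" "j < ?n" "i \<noteq> j" for i j
    using d that by (simp add: nth_eq_iff_index_eq)
  have ab: "?a \<noteq> ?b" "?a \<noteq> ?c" "?b \<noteq> ?c"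
    using neq[of 0 1] neq[of 0 2] neq[of 1 2] n by linarith+
  have db: "?d \<noteq> ?b" "?d \<noteq> ?c"
    using neq[of "3 mod ?n" 1] neq[of "3 mod ?n" 2] m n by linarith+
  have "{{?a, ?b}, {?b, ?c}, {?c, ?d}} \<subseteq> F"
  proof -
    have "vs \<noteq> []" using n by auto
    then show ?thesis using e[of 0] e[of 1] e[of 2] n by (simp add: numeral_eq_Suc)
  qed
  moreover have "card {{?a, ?b}, {?b, ?c}, {?c, ?d}} = 3"
    using ab db by (auto simp: doubleton_eq_iff card_insert_if)
  ultimately show ?thesis
    using card_mono[OF \<open>finite F\<close>] by metis
qed

lemma finite_K5_edges: "finite K5_edges"
  by (simp add: K5_edges_def complete_edges_def K5_vertices_def)

lemma small_in_desargues_faces: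
  assumes "F \<subseteq> K5_edges" "card F \<le> 2"
  shows "F \<in> desargues_faces"
proof -
  have "finite F" using assms finite_K5_edges finite_subset by blast
  then have "forest K5_vertices F"
    using assms graph_cycle_card[of F] by (fastforce simp: forest_def K5_edges_def)
  then show ?thesis using assms by (auto simp: desargues_faces_def)
qed

lemma desargues_faces_subset: "F \<in> desargues_faces \<Longrightarrow> F \<subseteq> K5_edges"
  by (fastforce simp: desargues_faces_def forest_def K5_edges_def complete_edges_def)

lemma L0_edges: "{{3, 4}, {3, 5}, {4, 5}} \<subseteq> K5_edges"
  by (simp add: K5_edges_def complete_edges_def K5_vertices_def)

lemma card_L0: "card {{3, 4}, {3, 5}, {4, 5 :: nat}} = 3"
  by (simp add: doubleton_eq_iff)

lemma desargues_faces_down: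
  assumes "X \<in> desargues_faces" "Y \<subseteq> X"
  shows "Y \<in> desargues_faces"
proof -
  obtain W where W: "W \<subseteq> K5_vertices" "forest W X" "card X \<le> 3"
    using assms(1) by (auto simp: desargues_faces_def)
  have "finite X"
    using desargues_faces_subset[OF assms(1)] finite_K5_edges finite_subset by blast
  then have "card Y \<le> 3" using W(3) card_mono[OF _ assms(2)] by simp
  moreover have "forest W Y"
    using W(2) assms(2) unfolding forest_def graph_cycle_def by blast
  ultimately show ?thesis using W(1) by (auto simp: desargues_faces_def)
qed

lemma simplicial_complex_non_desargues:
  "simplicial_complex K5_edges non_desargues_faces"
  unfolding simplicial_complex_def
proof (intro conjI ballI allI impI)
  show "finite K5_edges" by (rule finite_K5_edges)
  show "K5_edges \<noteq> {}" using L0_edges by auto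
  show "non_desargues_faces \<subseteq> Pow K5_edges"
    using desargues_faces_subset L0_edges by (auto simp: non_desargues_faces_def)
  show "{v} \<in> non_desargues_faces" if "v \<in> K5_edges" for v
    using small_in_desargues_faces[of "{v}"] that by (simp add: non_desargues_faces_def)
  show "Y \<in> non_desargues_faces" if X: "X \<in> non_desargues_faces" and Y: "Y \<subseteq> X" for X Y
  proof (cases "X \<in> desargues_faces")
    case True
    then show ?thesis using desargues_faces_down Y by (auto simp: non_desargues_faces_def)
  next
    case False
    then have X0: "X = {{3, 4}, {3, 5}, {4, 5}}"
      using X by (auto simp: non_desargues_faces_def)
    show ?thesis
    proof (cases "Y = X")
      case True
      then show ?thesis using X by simp
    next
      case False
      then have "card Y < card X"
        using Y X0 by (intro psubset_card_mono) auto
      then have "card Y \<le> 2" using X0 card_L0 by simp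
      then show ?thesis
        using small_in_desargues_faces[of Y] Y X0 L0_edges
        by (auto simp: non_desargues_faces_def)
    qed
  qed
qed

lemma complex_dim_non_desargues: "complex_dim non_desargues_faces = 2"
proof -
  have "non_desargues_faces \<subseteq> Pow K5_edges"
    using simplicial_complex_non_desargues by (simp add: simplicial_complex_def)
  then have fin: "finite (card ` non_desargues_faces)"
    using finite_K5_edges finite_subset by blast
  have "Max (card ` non_desargues_faces) = 3"
  proof (rule Max_eqI[OF fin])
    show "y \<le> 3" if "y \<in> card ` non_desargues_faces" for y
      using that card_L0 by (auto simp: non_desargues_faces_def desargues_faces_def)
    show "3 \<in> card ` non_desargues_faces"
      using card_L0 unfolding non_desargues_faces_def by (metis UnI2 image_eqI singletonI)
  qed
  then show ?thesis by (simp add: complex_dim_def)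
qed

end

theory Submission
  imports Defs
begin

text \<open>
  The triangles \<open>{13,14,15}\<close> and \<open>{23,24,25}\<close> are in perspective from the point \<open>12\<close>, and
  corresponding sides meet in \<open>34, 35, 45\<close>. In a matroid extending the complex, the plane spanned
  by either triangle contains \<open>L\<^sub>0\<close>; as \<open>L\<^sub>0\<close> is independent it spans both planes, hence also \<open>12\<close>.
  So \<open>L\<^sub>0\<close> is a basis, the rank is 3, and the extension is not proper. This is the spatial proof of
  Desargues' theorem, here carried out with the exchange property alone.
\<close>

abbreviation L0 :: "nat set set" where
  "L0 \<equiv> {{3, 4}, {3, 5}, {4, 5}}"

text \<open>Lying on the first two edges of a cycle forces \<open>c\<close> to be their common
  vertex \<open>vs ! 1\<close>, because \<open>vs ! 0\<close> and \<open>vs ! 2\<close> differ; but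
  that vertex misses the third edge.\<close>

lemma no_graph_cycle_star:
  assumes "\<And>e. e \<in> F \<Longrightarrow> c \<in> e"
  shows "\<not> graph_cycle F vs"
proof
  assume cyc: "graph_cycle F vs"
  let ?n = "length vs"
  have n: "3 \<le> ?n" and d: "distinct vs"
    and e: "\<And>i. i < ?n \<Longrightarrow> c \<in> {vs ! i, vs ! (Suc i mod ?n)}"
    using cyc assms by (auto simp: graph_cycle_def)
  have neq: "vs ! i \<noteq> vs ! j" if "i < ?n" "j < ?n" "i \<noteq> j" for i j
    using d that by (simp add: nth_eq_iff_index_eq)
  have "vs \<noteq> []"
    using n by auto
  then have "c = vs ! 0 \<or> c = vs ! 1" "c = vs ! 1 \<or> c = vs ! 2"
    using e[of 0] e[of 1] n by (auto simp: numeral_eq_Suc)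
  moreover have "vs ! 0 \<noteq> vs ! 2"
    using neq[of 0 2] n by linarith
  ultimately have "c = vs ! 1"
    by metis
  \<comment> \<open>The index \<open>3 mod ?n\<close> is 0 when the cycle is a triangle and 3
    otherwise; in both cases it differs from 1.\<close>
  moreover have "c = vs ! 2 \<or> c = vs ! (3 mod ?n)"
    using e[of 2] n by (auto simp: numeral_eq_Suc)
  moreover have "3 mod ?n = 0 \<or> 3 mod ?n = 3 \<and> 3 < ?n"
    using n by (cases "?n = 3") auto
  moreover have "vs ! 1 \<noteq> vs ! 2" "vs ! 1 \<noteq> vs ! (3 mod ?n)"
    using neq[of 1 2] neq[of 1 "3 mod ?n"] calculation(3) n by linarith+
  ultimately show False
    by metis
qed

lemma star_in_non_desargues_faces:
  assumes "F \<subseteq> K5_edges" "card F \<le> 3" "\<And>e. e \<in> F \<Longrightarrow> c \<in> e"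
  shows "F \<in> non_desargues_faces"
proof -
  have "forest K5_vertices F"
    using assms no_graph_cycle_star[of F c] by (auto simp: forest_def K5_edges_def)
  then show ?thesis
    using assms by (auto simp: non_desargues_faces_def desargues_faces_def)
qed

lemma graph_cycle_triangle:
  assumes "a \<noteq> b" "a \<noteq> c" "b \<noteq> c"
  shows "graph_cycle {{a, b}, {b, c}, {a, c}} [a, b, c]"
proof -
  have "{[a, b, c] ! i, [a, b, c] ! (Suc i mod 3)} \<in> {{a, b}, {b, c}, {a, c}}" if "i < 3" for i
  proof -
    from that consider "i = 0" | "i = 1" | "i = 2"
      by linarith
    then show ?thesis
      by cases (simp_all add: insert_commute)
  qed
  then show ?thesis
    using assms by (simp add: graph_cycle_def)
qed

text \<open>The condition on \<open>a\<close> rules out \<open>L0\<close>, the only triangle among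
  the faces, since \<open>L0\<close> covers just the vertices 3, 4, 5.\<close>

lemma triangle_notin_non_desargues_faces:
  assumes "a \<noteq> b" "a \<noteq> c" "b \<noteq> c" "a \<in> {1, 2}"
  shows "{{a, b}, {b, c}, {a, c}} \<notin> non_desargues_faces"
proof -
  have "{{a, b}, {b, c}, {a, c}} \<noteq> L0"
  proof
    assume "{{a, b}, {b, c}, {a, c}} = L0"
    then have "\<Union> {{a, b}, {b, c}, {a, c}} = \<Union> L0"
      by (rule arg_cong)
    then have "a \<in> {3, 4, 5}"
      by auto
    then show False
      using assms(4) by auto
  qed
  then show ?thesis
    using graph_cycle_triangle[OF assms(1-3)]
    by (auto simp: non_desargues_faces_def desargues_faces_def forest_def)
qed

lemma doubleton_in_K5_edges:
  "{a, b} \<in> K5_edges \<longleftrightarrow> a \<noteq> b \<and> a \<in> K5_vertices \<and> b \<in> K5_vertices"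
  by (auto simp: K5_edges_def complete_edges_def card_insert_if)

locale non_desargues_matroid_extension =
  fixes H
  assumes ext: "complex_extension K5_edges non_desargues_faces H"
    and mat: "matroid K5_edges H"
begin

text \<open>The complex has dimension 2, so an extension can only add sets of more than three
  edges.\<close>

lemma face_iff: "X \<in> H \<longleftrightarrow> X \<in> non_desargues_faces" if "X \<subseteq> K5_edges" "card X \<le> 3"
  using ext that complex_dim_non_desargues
  by (auto simp: complex_extension_def subsets_upto_def)

lemma face_subset: "X \<in> H \<Longrightarrow> X \<subseteq> K5_edges"
  using mat by (auto simp: matroid_def simplicial_complex_def)

lemma face_down: "X \<in> H \<Longrightarrow> Y \<subseteq> X \<Longrightarrow> Y \<in> H"
  using mat by (auto simp: matroid_def simplicial_complex_def)

lemma exchange: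
  assumes "I \<in> H" "J \<in> H" "card I = 4" "card J = 3"
  obtains i where "i \<in> I - J" "insert i J \<in> H"
proof -
  have "\<exists>i\<in>I - J. J \<union> {i} \<in> H"
    using mat assms by (simp add: matroid_def)
  then show thesis
    using that by auto
qed

lemma L0_face: "L0 \<in> H"
  using face_iff[OF L0_edges] card_L0 by (simp add: non_desargues_faces_def)

text \<open>Stars serve as the sets to be enlarged in the exchange arguments: they are always faces,
  and an edge joining the outer ends of two star edges closes a triangle.\<close>

lemma star_face:
  "{{c, x}, {c, y}, {c, z}} \<in> H"
  if "c \<in> K5_vertices" "{x, y, z} \<subseteq> K5_vertices - {c}"
proof -
  let ?F = "{{c, x}, {c, y}, {c, z}}"
  have "?F \<subseteq> K5_edges" "card ?F \<le> 3"
    using that by (auto simp: doubleton_in_K5_edges card_insert_if)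
  then show ?thesis
    using star_in_non_desargues_faces[of ?F c] face_iff by auto
qed

lemma no_triangle:
  assumes "X \<in> H" "{{a, b}, {b, c}, {a, c}} \<subseteq> X" "a \<in> {1, 2}" "a \<noteq> b" "a \<noteq> c" "b \<noteq> c"
  shows False
proof -
  let ?T = "{{a, b}, {b, c}, {a, c}}"
  have "?T \<in> H"
    using assms face_down by blast
  moreover have "card ?T \<le> 3"
    by (simp add: card_insert_if)
  ultimately have "?T \<in> non_desargues_faces"
    using face_iff[of ?T] face_subset[of ?T] by simp
  then show False
    using triangle_notin_non_desargues_faces[of a b c] assms by simp
qed

text \<open>Exchange would enlarge the star from \<open>a\<close> to 3, 4, 5. As
  \<open>{a, x}\<close> is already in it, the new edge is a side of \<open>L0\<close>, which closes
  a triangle through \<open>a\<close>.\<close>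

lemma perspective_triangle_spanned:
  assumes a: "a \<in> {1, 2}" and x: "x \<in> {3, 4, 5}"
  shows "insert {a, x} L0 \<notin> H"
proof
  let ?I = "insert {a, x} L0" and ?J = "{{a, 3}, {a, 4}, {a, 5}}"
  assume I: "?I \<in> H"
  have J: "?J \<in> H"
    using a by (intro star_face) (auto simp: K5_vertices_def)
  have "card ?I = 4" "card ?J = 3"
    using a by (auto simp: doubleton_eq_iff card_insert_if)
  then obtain i where i: "i \<in> ?I - ?J" "insert i ?J \<in> H"
    using exchange[OF I J] by blast
  then have "i \<in> L0"
    using x by auto
  then show False
  proof (elim insertE emptyE)
    assume "i = {3, 4}"
    then show False
      using a by (intro no_triangle[OF i(2), of a 3 4]) auto
  next
    assume "i = {3, 5}"
    then show False
      using a by (intro no_triangle[OF i(2), of a 3 5]) auto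
  next
    assume "i = {4, 5}"
    then show False
      using a by (intro no_triangle[OF i(2), of a 4 5]) auto
  qed
qed

text \<open>Exchange is used twice: first to enlarge a star at 3 to a face of four edges, then to
  enlarge \<open>L0\<close> by an edge of that face, which contradicts
  \<open>perspective_triangle_spanned\<close>.\<close>

lemma center_spanned: "insert {1, 2} L0 \<notin> H"
proof
  let ?I = "insert {1, 2} L0" and ?J = "{{3, 1}, {3, 2}, {3, 4 :: nat}}"
  assume I: "?I \<in> H"
  have J: "?J \<in> H"
    by (intro star_face) (auto simp: K5_vertices_def)
  have "card ?I = 4" "card ?J = 3"
    by (auto simp: doubleton_eq_iff card_insert_if)
  then obtain i where i: "i \<in> ?I - ?J" "insert i ?J \<in> H"
    using exchange[OF I J] by blast
  \<comment> \<open>Adding 12 to the star would close the triangle 123.\<close>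
  have "i \<noteq> {1, 2}"
    using no_triangle[OF i(2), of 1 2 3] by (auto simp: insert_commute)
  then have i': "i \<in> {{3, 5}, {4, 5}}"
    using i(1) by auto
  then have "card (insert i ?J) = 4"
    by (auto simp: doubleton_eq_iff card_insert_if)
  then obtain j where j: "j \<in> insert i ?J - L0" "insert j L0 \<in> H"
    using exchange[OF i(2) L0_face] card_L0 by blast
  \<comment> \<open>The edges 34 and \<open>i\<close> of the enlarged star lie in \<open>L0\<close>,
    so only 13 and 23 are left.\<close>
  then have "j = {1, 3} \<or> j = {2, 3}"
    using i' by (auto simp: insert_commute)
  then show False
    using j(2) perspective_triangle_spanned[of 1 3] perspective_triangle_spanned[of 2 3] by auto
qed

text \<open>An edge outside \<open>L0\<close> is either the center 12 or joins 1 or 2 to one of 3,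
  4, 5; both kinds have been excluded.\<close>

lemma L0_maximal:
  assumes "e \<in> K5_edges" "e \<notin> L0"
  shows "insert e L0 \<notin> H"
proof -
  obtain a b where "e = {a, b}" "a \<noteq> b"
    using assms(1) by (auto simp: K5_edges_def complete_edges_def card_2_iff)
  then have "e = {min a b, max a b}" "min a b < max a b"
    by (auto simp: min_def max_def)
  then obtain a b where e: "e = {a, b}" and "a < b"
    by blast
  have "a \<in> K5_vertices" "b \<in> K5_vertices"
    using assms(1) e doubleton_in_K5_edges[of a b] by simp_all
  then have "1 \<le> a" "b \<le> 5"
    by (auto simp: K5_vertices_def)
  have "a \<le> 2"
  proof (rule ccontr)
    assume "\<not> a \<le> 2"
    then consider "a = 3" "b = 4" | "a = 3" "b = 5" | "a = 4" "b = 5"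
      using \<open>a < b\<close> \<open>b \<le> 5\<close> by linarith
    then show False
      using assms(2) e by cases simp_all
  qed
  then consider "a = 1" | "a = 2"
    using \<open>1 \<le> a\<close> by linarith
  moreover consider "b = 2" | "b = 3" | "b = 4" | "b = 5"
    using \<open>1 \<le> a\<close> \<open>a < b\<close> \<open>b \<le> 5\<close> by linarith
  ultimately have "a = 1 \<and> b = 2 \<or> a \<in> {1, 2} \<and> b \<in> {3, 4, 5}"
    using \<open>a < b\<close> by blast
  then show ?thesis
    using center_spanned perspective_triangle_spanned[of a b] e by blast
qed

text \<open>A larger face would contain one with four edges, and exchange would then enlarge
  \<open>L0\<close>.\<close>

lemma card_face: "X \<in> H \<Longrightarrow> card X \<le> 3"
proof (rule ccontr)
  assume X: "X \<in> H" "\<not> card X \<le> 3"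
  then obtain I where I: "I \<subseteq> X" "card I = 4"
    using obtain_subset_with_card_n[of 4 X] by auto
  then have "I \<in> H"
    using X face_down by blast
  then obtain i where "i \<in> I - L0"
    "insert i L0 \<in> H"
    using exchange[OF _ L0_face] I card_L0 by blast
  then show False
    using L0_maximal face_subset by blast
qed

lemma extension_trivial: "H = non_desargues_faces"
proof
  show "H \<subseteq> non_desargues_faces"
    using card_face face_subset face_iff by blast
  show "non_desargues_faces \<subseteq> H"
    using ext by (auto simp: complex_extension_def)
qed

end

theorem theorem9p5:
  shows "\<not> (\<exists>H'. proper_extension K5_edges non_desargues_faces H' \<and> matroid K5_edges H')"
  using non_desargues_matroid_extension.extension_trivial
  by (auto simp: proper_extension_def non_desargues_matroid_extension_def)

end
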